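(* For every real $t$ with $0\le t\le 1$ (where at $t=0$ each right-hand side below is interpreted as its limiting value $0$), the following hold: (1) $\displaystyle \mathrm{Li}_2(t)\ge\frac{4}{3\pi}\,\frac{(\sin^{-1}t)^3}{t}$; (2) $\displaystyle \chi_2(t)\ge\frac{(\sin^{-1}t)^2}{2t}$; (3) $\displaystyle \mathrm{Ti}_2(t)\ge\frac{(\sinh^{-1}t)^2}{2t}$.
   Context: For $0\le t\le 1$: $\mathrm{Li}_2(t)=\sum_{n=1}^\infty \frac{t^n}{n^2}$ (dilogarithm), $\chi_2(t)=\sum_{n=1}^\infty\frac{t^{2n-1}}{(2n-1)^2}$ (Legendre $\chi$ function of order 2), and $\mathrm{Ti}_2(t)=\sum_{n=1}^\infty\frac{(-1)^{n-1}}{(2n-1)^2}t^{2n-1}$. Here $\sin^{-1}$ is the real inverse sine with values in $[-\pi/2,\pi/2]$, and $\sinh^{-1}x=\log(x+\sqrt{x^2+1})$. *)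

theory Defs
  imports "HOL-Analysis.Analysis"
begin

text \<open>
  The sums start at \<open>n = 1\<close> in the usual presentation; they are written here over \<open>n \<ge> 0\<close>,
  with \<open>n\<close> replaced by \<open>n + 1\<close>. The definitions are meant for \<open>0 \<le> t \<le> 1\<close>, where all three
  series converge (see the summability lemmas below).
\<close>

definition Li2 :: "real \<Rightarrow> real" where
  "Li2 t = (\<Sum>n. t ^ (n + 1) / real (n + 1) ^ 2)"

definition chi2 :: "real \<Rightarrow> real" where
  "chi2 t = (\<Sum>n. t ^ (2 * n + 1) / real (2 * n + 1) ^ 2)"

definition Ti2 :: "real \<Rightarrow> real" where
  "Ti2 t = (\<Sum>n. (-1) ^ n / real (2 * n + 1) ^ 2 * t ^ (2 * n + 1))"

lemma summable_inverse_square: "summable (\<lambda>n. 1 / real (n + 1) ^ 2)"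
  using summable_Suc_iff[of "\<lambda>n. inverse (real n ^ 2)"] inverse_power_summable[of 2, where 'a = real]
  by (simp add: inverse_eq_divide)

lemma summable_Li2:
  assumes "0 \<le> t" "t \<le> (1::real)"
  shows "summable (\<lambda>n. t ^ (n + 1) / real (n + 1) ^ 2)"
proof (rule summable_comparison_test'[OF summable_inverse_square, of 0])
  fix n :: nat
  show "norm (t ^ (n + 1) / real (n + 1) ^ 2) \<le> 1 / real (n + 1) ^ 2"
    using assms power_le_one[of t "n + 1"]
    by (simp add: norm_divide norm_power divide_right_mono del: power_Suc)
qed

lemma odd_square_bound:
  assumes "0 \<le> t" "t \<le> (1::real)"
  shows "t ^ (2 * n + 1) / real (2 * n + 1) ^ 2 \<le> 1 / real (n + 1) ^ 2"
  using assms by (intro frac_le power_mono power_le_one) auto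

lemma summable_chi2:
  assumes "0 \<le> t" "t \<le> (1::real)"
  shows "summable (\<lambda>n. t ^ (2 * n + 1) / real (2 * n + 1) ^ 2)"
proof (rule summable_comparison_test'[OF summable_inverse_square, of 0])
  fix n :: nat
  show "norm (t ^ (2 * n + 1) / real (2 * n + 1) ^ 2) \<le> 1 / real (n + 1) ^ 2"
    using odd_square_bound[OF assms, of n] assms by (simp add: abs_mult power_abs)
qed

lemma summable_Ti2:
  assumes "0 \<le> t" "t \<le> (1::real)"
  shows "summable (\<lambda>n. (-1) ^ n / real (2 * n + 1) ^ 2 * t ^ (2 * n + 1))"
proof (rule summable_comparison_test'[OF summable_inverse_square, of 0])
  fix n :: nat
  show "norm ((-1) ^ n / real (2 * n + 1) ^ 2 * t ^ (2 * n + 1)) \<le> 1 / real (n + 1) ^ 2"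
    using odd_square_bound[OF assms, of n] assms by (simp add: abs_mult power_abs)
qed

end

theory Submission
  imports Defs
begin

text \<open>
  The third inequality is far from sharp: the first two terms of the alternating series give
  \<open>Ti2 t \<ge> t - t\<^sup>3 / 9 \<ge> t / 2\<close>, and \<open>arsinh t \<le> t\<close>.

  The other two are equalities at \<open>t = 0\<close> (after multiplication by \<open>t\<close>) and, by
  \<open>Li2 1 = \<pi>\<^sup>2 / 6\<close> and \<open>chi2 1 = \<pi>\<^sup>2 / 8\<close>, at \<open>t = 1\<close>. The substitution
  \<open>t = sin x\<close> turns each of them into \<open>h x \<ge> 0\<close> on \<open>[0, \<pi> / 2]\<close>, where
  \<open>h x = sin x * f (sin x) - k x\<close>, with \<open>f\<close> one of the two functions and \<open>k\<close> a power of
  \<open>x\<close> with a constant factor. Here \<open>h\<close> vanishes at both ends, and to second order at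
  \<open>0\<close>. If \<open>h''\<close> is decreasing, then \<open>h\<close> is first convex, hence nonnegative because it
  starts with slope \<open>0\<close>, and then concave, hence above the chord that joins a nonnegative value
  to the value \<open>0\<close> at \<open>\<pi> / 2\<close>.

  Both functions satisfy \<open>f' t = m t / t\<close> with \<open>m\<close> elementary, namely
  \<open>m t = - ln (1 - t)\<close> for the dilogarithm and \<open>m = artanh\<close> for the chi function. So
  \<open>h''\<close>, as a function of \<open>t\<close>, involves only \<open>f\<close> and elementary functions, and one
  further differentiation, with the first terms of the Taylor series of \<open>m\<close> as a lower bound for
  \<open>m\<close>, shows that it decreases. Only the dilogarithm needs an analysis of its power series,
  because \<open>chi2 t = Li2 t - Li2 (t\<^sup>2) / 4\<close>.
\<close>

section \<open>A comparison principle for the sine substitution\<close>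

text \<open>
  A negative value \<open>h x\<close> makes the slope \<open>g\<close> negative somewhere before \<open>x\<close> and positive
  somewhere after it. As \<open>g\<close> starts at \<open>0\<close>, its derivative \<open>w\<close> then takes a negative
  value followed by a positive one. The interval for the slope is half-open, since in the
  applications \<open>g\<close> contains \<open>ln (1 - t)\<close> or \<open>artanh t\<close>, which are singular at
  \<open>t = 1\<close>, and \<open>t = 1\<close> corresponds to \<open>b\<close>.
\<close>

lemma nonneg_if_second_deriv_changes_sign_once:
  fixes h g w :: "real \<Rightarrow> real"
  assumes b: "0 < b"
    and h_cont: "continuous_on {0..b} h"
    and h_deriv: "\<And>x. 0 < x \<Longrightarrow> x < b \<Longrightarrow> (h has_real_derivative g x) (at x)"
    and g_cont: "continuous_on {0..<b} g"
    and g_deriv: "\<And>x. 0 < x \<Longrightarrow> x < b \<Longrightarrow> (g has_real_derivative w x) (at x)"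
    and ends: "h 0 = 0" "h b = 0" "g 0 = 0"
    and sign: "\<And>x y. 0 < x \<Longrightarrow> x < y \<Longrightarrow> y < b \<Longrightarrow> w x < 0 \<Longrightarrow> w y \<le> 0"
    and x: "0 \<le> x" "x \<le> b"
  shows "0 \<le> h x"
proof (rule ccontr)
  assume "\<not> 0 \<le> h x"
  then have neg: "h x < 0" by simp
  have x': "0 < x" "x < b"
    using neg ends x by (auto simp: less_le)
  have mvt: "\<exists>z. u < z \<and> z < v \<and> p v - p u = (v - u) * p' z"
    if "u < v" and cont: "continuous_on {u..v} p"
      and deriv: "\<And>z. u < z \<Longrightarrow> z < v \<Longrightarrow> (p has_real_derivative p' z) (at z)"
    for u v and p p' :: "real \<Rightarrow> real"
  proof -
    have "p differentiable at z" if "u < z" "z < v" for z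
      using deriv[OF that] real_differentiable_def by blast
    from MVT[OF \<open>u < v\<close> cont this] obtain l z
      where "u < z" "z < v" "(p has_real_derivative l) (at z)" "p v - p u = (v - u) * l"
      by blast
    then show ?thesis
      using deriv DERIV_unique by blast
  qed
  obtain c where c: "0 < c" "c < x" "h x - h 0 = (x - 0) * g c"
    using mvt[of 0 x h g] x' h_deriv continuous_on_subset[OF h_cont] by force
  have gc: "g c < 0"
    using c neg ends x' by (auto simp: mult_less_0_iff)
  obtain d where d: "x < d" "d < b" "h b - h x = (b - x) * g d"
    using mvt[of x b h g] x' h_deriv continuous_on_subset[OF h_cont] by force
  have gd: "0 < g d"
  proof -
    have "0 < (b - x) * g d" using d neg ends by simp
    then show ?thesis using x' by (simp add: zero_less_mult_iff)
  qed
  obtain y where y: "0 < y" "y < c" "g c - g 0 = (c - 0) * w y"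
    using mvt[of 0 c g w] c x' g_deriv continuous_on_subset[OF g_cont, of "{0..c}"] by force
  have wy: "w y < 0"
    using y gc ends c by (auto simp: mult_less_0_iff)
  obtain z where z: "c < z" "z < d" "g d - g c = (d - c) * w z"
    using mvt[of c d g w] c d g_deriv continuous_on_subset[OF g_cont, of "{c..d}"] by force
  have wz: "0 < w z"
  proof -
    have "0 < (d - c) * w z" using z gc gd by simp
    then show ?thesis using c d by (simp add: zero_less_mult_iff)
  qed
  show False
    using sign[of y z] y z d wy wz by simp
qed

text \<open>
  The expression in the hypothesis \<open>decreasing\<close> is the second derivative of
  \<open>sin x * f (sin x) - k x\<close>, written in terms of \<open>t = sin x\<close>.
\<close>

lemma comparison_by_sine_substitution:
  fixes f m m' k k' k'' :: "real \<Rightarrow> real"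
  assumes f_cont: "continuous_on {0..1} f"
    and f_deriv: "\<And>t. 0 < t \<Longrightarrow> t < 1 \<Longrightarrow> (f has_real_derivative m t / t) (at t)"
    and m_cont: "continuous_on {0..<1} m"
    and m_deriv: "\<And>t. 0 < t \<Longrightarrow> t < 1 \<Longrightarrow> (m has_real_derivative m' t) (at t)"
    and k_deriv: "\<And>x. (k has_real_derivative k' x) (at x)"
    and k'_deriv: "\<And>x. (k' has_real_derivative k'' x) (at x)"
    and ends: "f 0 = 0" "m 0 = 0" "k 0 = 0" "k' 0 = 0" "f 1 = k (pi / 2)"
    and decreasing: "\<And>s t. 0 < s \<Longrightarrow> s < t \<Longrightarrow> t < 1 \<Longrightarrow>
      (1 - t\<^sup>2) * (m t / t + m' t) - t * (f t + m t) - k'' (arcsin t)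
      \<le> (1 - s\<^sup>2) * (m s / s + m' s) - s * (f s + m s) - k'' (arcsin s)"
    and t: "0 \<le> t" "t \<le> 1"
  shows "k (arcsin t) \<le> t * f t"
proof -
  define h where "h x = sin x * f (sin x) - k x" for x
  define g where "g x = cos x * (f (sin x) + m (sin x)) - k' x" for x
  define W where
    "W t = (1 - t\<^sup>2) * (m t / t + m' t) - t * (f t + m t) - k'' (arcsin t)" for t
  have sin_lt_1: "sin x < 1" if "0 \<le> x" "x < pi / 2" for x :: real
    using sin_monotone_2pi[of x "pi / 2"] that by simp
  have sin_pos: "0 < sin x" if "0 < x" "x < pi / 2" for x :: real
    using that by (simp add: sin_gt_zero)
  have k_cont: "continuous_on S k" and k'_cont: "continuous_on S k'" for S
    using DERIV_continuous_on[of S k k'] DERIV_continuous_on[of S k' k'']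
      has_field_derivative_at_within[OF k_deriv] has_field_derivative_at_within[OF k'_deriv]
    by blast+
  have nonneg: "0 \<le> h (arcsin t)"
  proof (rule nonneg_if_second_deriv_changes_sign_once[where b = "pi / 2" and h = h and g = g
        and w = "\<lambda>x. W (sin x)"])
    show "continuous_on {0..pi / 2} h"
      unfolding h_def
      by (intro continuous_intros k_cont continuous_on_compose2[OF f_cont]) (auto intro!: sin_ge_zero)
    show "continuous_on {0..<pi / 2} g"
      unfolding g_def
      by (intro continuous_intros k'_cont continuous_on_compose2[OF f_cont]
          continuous_on_compose2[OF m_cont]) (auto intro!: sin_ge_zero sin_lt_1)
    show "(h has_real_derivative g x) (at x)" if x: "0 < x" "x < pi / 2" for x
    proof -
      have s: "0 < sin x" "sin x < 1" using sin_pos sin_lt_1 x by auto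
      have "((\<lambda>x. f (sin x)) has_real_derivative (m (sin x) / sin x) * cos x) (at x)"
        by (rule DERIV_chain2[where g = sin, OF f_deriv[OF s] DERIV_sin])
      then show ?thesis
        unfolding h_def g_def using s
        by (auto intro!: derivative_eq_intros k_deriv simp: algebra_simps)
    qed
    show "(g has_real_derivative W (sin x)) (at x)" if x: "0 < x" "x < pi / 2" for x
    proof -
      have s: "0 < sin x" "sin x < 1" using sin_pos sin_lt_1 x by auto
      have f: "((\<lambda>x. f (sin x)) has_real_derivative (m (sin x) / sin x) * cos x) (at x)"
        by (rule DERIV_chain2[where g = sin, OF f_deriv[OF s] DERIV_sin])
      have m: "((\<lambda>x. m (sin x)) has_real_derivative m' (sin x) * cos x) (at x)"
        by (rule DERIV_chain2[where g = sin, OF m_deriv[OF s] DERIV_sin])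
      have "(g has_real_derivative
          - sin x * (f (sin x) + m (sin x))
          + cos x * ((m (sin x) / sin x) * cos x + m' (sin x) * cos x) - k'' x) (at x)"
        unfolding g_def
        by (rule derivative_eq_intros f m k'_deriv refl)+ (simp add: algebra_simps)
      moreover have "- sin x * (f (sin x) + m (sin x))
          + cos x * ((m (sin x) / sin x) * cos x + m' (sin x) * cos x) - k'' x = W (sin x)"
        using x by (simp add: W_def arcsin_sin cos_squared_eq[symmetric] power2_eq_square[of "cos x"] algebra_simps)
      ultimately show ?thesis by simp
    qed
    show "W (sin y) \<le> 0" if "0 < x" "x < y" "y < pi / 2" "W (sin x) < 0" for x y
      using decreasing[of "sin x" "sin y"] that sin_pos[of x] sin_lt_1[of y]
        sin_monotone_2pi[of x y] by (simp add: W_def)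
    show "0 \<le> arcsin t" "arcsin t \<le> pi / 2"
      using t arcsin_ubound[of t] arcsin_le_arcsin[of 0 t] by auto
  qed (use ends in \<open>auto simp: h_def g_def\<close>)
  then show ?thesis
    using t by (simp add: h_def)
qed

section \<open>The dilogarithm and the Legendre chi function\<close>

lemma Li2_0 [simp]: "Li2 0 = 0"
  by (simp add: Li2_def)

lemma Li2_1: "Li2 1 = pi\<^sup>2 / 6"
  using inverse_squares_sums by (simp add: Li2_def sums_iff add.commute)

lemma Li2_nonneg: "0 \<le> t \<Longrightarrow> t \<le> 1 \<Longrightarrow> 0 \<le> Li2 t"
  unfolding Li2_def by (rule suminf_nonneg[OF summable_Li2]) auto

lemma continuous_on_Li2: "continuous_on {0..1} Li2"
proof -
  have "uniform_limit {0..1} (\<lambda>N t. \<Sum>n<N. t ^ (n + 1) / real (n + 1) ^ 2)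
      (\<lambda>t. \<Sum>n. t ^ (n + 1) / real (n + 1) ^ 2) sequentially"
  proof (rule Weierstrass_m_test[OF _ summable_inverse_square])
    fix n and t :: real assume "t \<in> {0..1}"
    then show "norm (t ^ (n + 1) / real (n + 1) ^ 2) \<le> 1 / real (n + 1) ^ 2"
      using power_le_one[of t "n + 1"]
      by (simp add: norm_divide norm_power divide_right_mono del: power_Suc)
  qed
  moreover have "\<forall>\<^sub>F N in sequentially.
      continuous_on {0..1} (\<lambda>t::real. \<Sum>n<N. t ^ (n + 1) / real (n + 1) ^ 2)"
    by (intro always_eventually allI continuous_intros) auto
  ultimately show ?thesis
    unfolding Li2_def[abs_def] by (intro uniform_limit_theorem) auto
qed

text \<open>
  Termwise differentiation gives \<open>\<Sum>n. t ^ n / (n + 1)\<close>, which is the Mercator series of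
  \<open>- ln (1 - t)\<close> divided by \<open>t\<close>.
\<close>

lemma DERIV_Li2:
  assumes "0 < t" "t < 1"
  shows "(Li2 has_real_derivative - ln (1 - t) / t) (at t)"
proof -
  (* The coefficient at n = 0 is 1 / 0 = 0, so the dilogarithm is the full power series. *)
  define c :: "nat \<Rightarrow> real" where "c n = 1 / real n ^ 2" for n
  have summable_c: "summable (\<lambda>n. c n * s ^ n)" if "0 \<le> s" "s \<le> 1" for s
    using summable_Li2[OF that]
    by (subst summable_Suc_iff[symmetric]) (simp add: c_def)
  have Li2_eq: "(\<Sum>n. c n * s ^ n) = Li2 s" if "s \<in> {0<..<1}" for s
    using suminf_split_head[OF summable_c[of s]] that
    by (simp add: Li2_def c_def)
  have diffs: "diffs c n = 1 / real (n + 1)" for n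
    by (simp add: diffs_def c_def power2_eq_square)
  have "(\<lambda>n. t ^ n / real n) sums (- ln (1 - t))"
    using sums_minus[OF ln_series'[of "- t"]] assms by simp
  then have "(\<lambda>n. t ^ Suc n / real (Suc n)) sums (- ln (1 - t))"
    by (subst sums_Suc_iff) simp
  then have "(\<lambda>n. t ^ Suc n / real (Suc n) / t) sums (- ln (1 - t) / t)"
    by (rule sums_divide)
  moreover have "t ^ Suc n / real (Suc n) / t = diffs c n * t ^ n" for n
    using assms by (simp add: diffs)
  ultimately have "(\<Sum>n. diffs c n * t ^ n) = - ln (1 - t) / t"
    by (simp add: sums_iff)
  moreover have "((\<lambda>s. \<Sum>n. c n * s ^ n) has_real_derivative (\<Sum>n. diffs c n * t ^ n)) (at t)"
    by (rule termdiffs_strong[where K = 1]) (use summable_c[of 1] assms in auto)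
  ultimately show ?thesis
    using has_field_derivative_transform_within_open[of _ _ t "{0<..<1}" Li2] Li2_eq assms
    by simp
qed

text \<open>
  Removing the even powers from the dilogarithm leaves the chi function, and the even powers
  form a dilogarithm in \<open>t\<^sup>2\<close> because \<open>(2 * n)\<^sup>2 = 4 * n\<^sup>2\<close>.
\<close>

lemma chi2_eq_Li2:
  assumes "0 \<le> t" "t \<le> 1"
  shows "chi2 t = Li2 t - Li2 (t\<^sup>2) / 4"
proof -
  have t2: "0 \<le> t\<^sup>2" "t\<^sup>2 \<le> 1"
    using assms by (auto simp: power_le_one)
  have "(\<lambda>n. \<Sum>i = n * 2..<n * 2 + 2. t ^ (i + 1) / real (i + 1) ^ 2) sums Li2 t"
    unfolding Li2_def by (rule sums_group[OF summable_sums[OF summable_Li2[OF assms]]]) simp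
  moreover have "(\<lambda>n. t ^ (2 * n + 1) / real (2 * n + 1) ^ 2
        + (t\<^sup>2) ^ (n + 1) / real (n + 1) ^ 2 / 4) sums (chi2 t + Li2 (t\<^sup>2) / 4)"
    unfolding Li2_def chi2_def
    by (intro sums_add sums_divide summable_sums summable_chi2 summable_Li2 assms t2)
  moreover have "(\<Sum>i = n * 2..<n * 2 + 2. t ^ (i + 1) / real (i + 1) ^ 2)
      = t ^ (2 * n + 1) / real (2 * n + 1) ^ 2 + (t\<^sup>2) ^ (n + 1) / real (n + 1) ^ 2 / 4" for n
  proof -
    have "real (2 * n + 2) ^ 2 = 4 * real (n + 1) ^ 2"
      by (simp add: power2_eq_square algebra_simps)
    moreover have "(t\<^sup>2) ^ (n + 1) = t ^ (2 * n + 2)"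
      by (simp only: power_mult[symmetric]) simp
    moreover have "{n * 2..<n * 2 + 2} = {2 * n, 2 * n + 1}" by auto
    ultimately show ?thesis by simp
  qed
  ultimately show ?thesis
    using sums_unique2 by fastforce
qed

lemma continuous_on_chi2: "continuous_on {0..1} chi2"
proof -
  have "continuous_on {0..1} (\<lambda>t. Li2 t - Li2 (t\<^sup>2) / 4)"
    by (intro continuous_intros continuous_on_Li2 continuous_on_compose2[OF continuous_on_Li2])
      (auto simp: power_le_one)
  then show ?thesis
    by (rule continuous_on_eq) (simp add: chi2_eq_Li2)
qed

lemma DERIV_chi2:
  assumes "0 < t" "t < 1"
  shows "(chi2 has_real_derivative artanh t / t) (at t)"
proof -
  have "t\<^sup>2 < 1" using assms by (simp add: power_less_one_iff)
  have sq: "((\<lambda>t. Li2 (t\<^sup>2)) has_real_derivative - ln (1 - t\<^sup>2) / t\<^sup>2 * (2 * t)) (at t)"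
    by (rule DERIV_chain2[OF DERIV_Li2])
      (use assms \<open>t\<^sup>2 < 1\<close> in \<open>auto intro!: derivative_eq_intros\<close>)
  have "((\<lambda>t. Li2 t - Li2 (t\<^sup>2) / 4) has_real_derivative
      - ln (1 - t) / t - - ln (1 - t\<^sup>2) / t\<^sup>2 * (2 * t) / 4) (at t)"
    by (intro DERIV_diff DERIV_cdivide DERIV_Li2 sq assms)
  moreover have "- ln (1 - t) / t - - ln (1 - t\<^sup>2) / t\<^sup>2 * (2 * t) / 4 = artanh t / t"
  proof -
    have "1 - t\<^sup>2 = (1 + t) * (1 - t)" by (simp add: power2_eq_square algebra_simps)
    then have "ln (1 - t\<^sup>2) = ln (1 + t) + ln (1 - t)"
      using assms by (simp add: ln_mult)
    then show ?thesis
      using assms by (simp add: artanh_def ln_div field_simps power2_eq_square)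
  qed
  ultimately show ?thesis
    using has_field_derivative_transform_within_open[of _ _ t "{0<..<1}" chi2] assms
    by (simp add: chi2_eq_Li2)
qed

section \<open>The three inequalities\<close>

lemma artanh_ge_self:
  assumes "0 \<le> t" "t < (1::real)"
  shows "t \<le> artanh t"
proof -
  have "artanh 0 - 0 \<le> artanh t - t"
  proof (rule DERIV_nonneg_imp_nondecreasing[OF assms(1)])
    fix s assume s: "0 \<le> s" "s \<le> t"
    then have "s\<^sup>2 < 1" using assms by (simp add: power_less_one_iff)
    then show "\<exists>y. ((\<lambda>s. artanh s - s) has_real_derivative y) (at s) \<and> 0 \<le> y"
      using s assms
      by (intro exI[of _ "1 / (1 - s\<^sup>2) - 1"])
        (auto intro!: derivative_eq_intros simp: field_simps)
  qed
  then show ?thesis by simp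
qed

lemma neg_ln_one_minus_ge:
  assumes "0 \<le> t" "t < (1::real)"
  shows "t + t\<^sup>2 / 2 \<le> - ln (1 - t)"
proof -
  have "- ln (1 - 0) - 0 - 0\<^sup>2 / 2 \<le> - ln (1 - t) - t - t\<^sup>2 / 2"
  proof (rule DERIV_nonneg_imp_nondecreasing[OF assms(1)])
    fix s assume s: "0 \<le> s" "s \<le> t"
    have "0 \<le> 1 / (1 - s) - 1 - s"
      using s assms by (simp add: field_simps)
    then show "\<exists>y. ((\<lambda>s. - ln (1 - s) - s - s\<^sup>2 / 2) has_real_derivative y) (at s) \<and> 0 \<le> y"
      using s assms
      by (intro exI[of _ "1 / (1 - s) - 1 - s"]) (auto intro!: derivative_eq_intros)
  qed
  then show ?thesis by simp
qed

lemma chi2_0 [simp]: "chi2 0 = 0"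
  by (simp add: chi2_def)

lemma chi2_nonneg: "0 \<le> t \<Longrightarrow> t \<le> 1 \<Longrightarrow> 0 \<le> chi2 t"
  unfolding chi2_def by (rule suminf_nonneg[OF summable_chi2]) auto

text \<open>
  The second derivative, in terms of \<open>t = sin x\<close>, simplifies to the function \<open>V\<close> below.
  In its derivative the terms \<open>1 / (1 - t\<^sup>2)\<close>, which blow up at \<open>t = 1\<close>, have a negative
  sum once \<open>artanh t \<ge> t\<close> has removed the term of order \<open>1 / t\<close>.
\<close>

lemma chi2_bound:
  assumes "0 \<le> t" "t \<le> 1"
  shows "(arcsin t)\<^sup>2 / 2 \<le> t * chi2 t"
proof (rule comparison_by_sine_substitution[where m = artanh and m' = "\<lambda>t. 1 / (1 - t\<^sup>2)"
      and k = "\<lambda>x. x\<^sup>2 / 2" and k' = "\<lambda>x. x" and k'' = "\<lambda>_. 1"])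
  show "continuous_on {0..<1} (artanh :: real \<Rightarrow> real)"
    by (intro continuous_intros) auto
  show "(artanh has_real_derivative 1 / (1 - t\<^sup>2)) (at t)" if "0 < t" "t < 1" for t :: real
    using that by (auto intro!: derivative_eq_intros)
  show "chi2 1 = (pi / 2)\<^sup>2 / 2"
    by (simp add: chi2_eq_Li2 Li2_1 power2_eq_square)
  fix s t :: real
  assume st: "0 < s" "s < t" "t < 1"
  define V where "V t = artanh t / t - 2 * t * artanh t - t * chi2 t" for t
  have "V t \<le> V s"
  proof (rule DERIV_nonpos_imp_nonincreasing[of s t V])
    fix u assume "s \<le> u" "u \<le> t"
    then have u: "0 < u" "u < 1" using st by auto
    then have u2: "u\<^sup>2 < 1" by (simp add: power_less_one_iff)
    define D where "D = 1 / (1 - u\<^sup>2)"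
    have D: "1 \<le> D" using u u2 by (simp add: D_def field_simps)
    have "(V has_real_derivative
        (D * u - artanh u) / u\<^sup>2 - 2 * (artanh u + u * D) - (chi2 u + artanh u)) (at u)"
      unfolding V_def[abs_def] D_def
      using u by (auto intro!: derivative_eq_intros DERIV_chi2 simp: power2_eq_square field_simps)
    moreover have "(D * u - artanh u) / u\<^sup>2 - 2 * (artanh u + u * D) - (chi2 u + artanh u) \<le> 0"
    proof -
      have "u \<le> artanh u" using artanh_ge_self u by simp
      moreover have "(D * u - artanh u) / u\<^sup>2 \<le> (D * u - u) / u\<^sup>2"
        using calculation by (intro divide_right_mono) auto
      moreover have "(D * u - u) / u\<^sup>2 = u * D"
        using u u2 by (simp add: D_def field_simps power2_eq_square)
      moreover have "0 \<le> u * D" using u D by simp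
      ultimately show ?thesis
        using chi2_nonneg[of u] u by simp
    qed
    ultimately show "\<exists>y. (V has_real_derivative y) (at u) \<and> y \<le> 0" by blast
  qed (use st in auto)
  moreover have "(1 - u\<^sup>2) * (artanh u / u + 1 / (1 - u\<^sup>2)) - u * (chi2 u + artanh u) - 1 = V u"
    if "0 < u" "u < 1" for u
  proof -
    have "u\<^sup>2 < 1" using that by (simp add: power_less_one_iff)
    then have "(1 - u\<^sup>2) * (1 / (1 - u\<^sup>2)) = 1" by simp
    moreover have "(1 - u\<^sup>2) * (artanh u / u) = artanh u / u - u * artanh u"
      using that by (simp add: field_simps power2_eq_square)
    ultimately show ?thesis
      unfolding V_def by (simp only: distrib_left)
  qed
  ultimately show "(1 - t\<^sup>2) * (artanh t / t + 1 / (1 - t\<^sup>2)) - t * (chi2 t + artanh t) - 1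
      \<le> (1 - s\<^sup>2) * (artanh s / s + 1 / (1 - s\<^sup>2)) - s * (chi2 s + artanh s) - 1"
    using st by simp
qed (use assms continuous_on_chi2 in \<open>auto intro!: DERIV_chi2 derivative_eq_intros\<close>)

text \<open>
  Here the bound on \<open>- ln (1 - t)\<close> has to include the quadratic term: the derivative of \<open>V\<close>
  is then at most \<open>3 / 2 - 8 / \<pi>\<close>, where \<open>8 / \<pi>\<close> comes from the derivative of
  \<open>arcsin\<close>, and \<open>\<pi> < 4\<close> suffices.
\<close>

lemma Li2_bound:
  assumes "0 \<le> t" "t \<le> 1"
  shows "4 / (3 * pi) * (arcsin t) ^ 3 \<le> t * Li2 t"
proof (rule comparison_by_sine_substitution[where m = "\<lambda>t. - ln (1 - t)" and m' = "\<lambda>t. 1 / (1 - t)"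
      and k = "\<lambda>x. 4 / (3 * pi) * x ^ 3" and k' = "\<lambda>x. 4 / pi * x\<^sup>2" and k'' = "\<lambda>x. 8 / pi * x"])
  show "continuous_on {0..<1} (\<lambda>t::real. - ln (1 - t))"
    by (intro continuous_intros) auto
  show "((\<lambda>t. - ln (1 - t)) has_real_derivative 1 / (1 - t)) (at t)" if "0 < t" "t < 1" for t :: real
    using that by (auto intro!: derivative_eq_intros)
  show "Li2 1 = 4 / (3 * pi) * (pi / 2) ^ 3"
    by (simp add: Li2_1 power2_eq_square power3_eq_cube)
  show "((\<lambda>x. 4 / (3 * pi) * x ^ 3) has_real_derivative 4 / pi * x\<^sup>2) (at x)" for x
    by (rule derivative_eq_intros refl)+ simp
  show "((\<lambda>x. 4 / pi * x\<^sup>2) has_real_derivative 8 / pi * x) (at x)" for x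
    by (rule derivative_eq_intros refl)+ simp
  fix s t :: real
  assume st: "0 < s" "s < t" "t < 1"
  define m :: "real \<Rightarrow> real" where "m t = - ln (1 - t)" for t
  define V where "V t = m t / t - 2 * (t * m t) + 1 + t - t * Li2 t - 8 / pi * arcsin t" for t
  have "V t \<le> V s"
  proof (rule DERIV_nonpos_imp_nonincreasing[of s t V])
    fix u assume "s \<le> u" "u \<le> t"
    then have u: "0 < u" "u < 1" using st by auto
    then have u2: "u\<^sup>2 < 1" by (simp add: power_less_one_iff)
    define D where "D = 1 / (1 - u)"
    define A where "A = 1 / sqrt (1 - u\<^sup>2)"
    have "(V has_real_derivative
        (D * u - m u) / u\<^sup>2 - 2 * (m u + u * D) + 1 - (Li2 u + m u) - 8 / pi * A) (at u)"
    proof -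
      have m: "(m has_real_derivative D) (at u)"
        unfolding m_def[abs_def] D_def using u by (auto intro!: derivative_eq_intros)
      have Li2: "(Li2 has_real_derivative m u / u) (at u)"
        unfolding m_def using u by (rule DERIV_Li2)
      have arcsin: "(arcsin has_real_derivative A) (at u)"
        unfolding A_def using DERIV_arcsin[of u] u by (simp only: inverse_eq_divide)
      show ?thesis
        unfolding V_def[abs_def] using u
        by (auto intro!: derivative_eq_intros m Li2 arcsin
            simp: A_def inverse_eq_divide power2_eq_square algebra_simps)
    qed
    moreover have "(D * u - m u) / u\<^sup>2 - 2 * (m u + u * D) + 1 - (Li2 u + m u) - 8 / pi * A \<le> 0"
    proof -
      have m: "u + u\<^sup>2 / 2 \<le> m u" unfolding m_def using neg_ln_one_minus_ge u by simp
      then have "0 \<le> m u" using u by (smt (verit) zero_le_power2 divide_nonneg_nonneg)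
      moreover have "(D * u - m u) / u\<^sup>2 \<le> (D * u - (u + u\<^sup>2 / 2)) / u\<^sup>2"
        using m by (intro divide_right_mono) auto
      moreover have "(D * u - (u + u\<^sup>2 / 2)) / u\<^sup>2 = D - 1 / 2"
        using u by (simp add: D_def field_simps power2_eq_square)
      moreover have "D - 2 * (u * D) = 1 - u * D"
        using u by (simp add: D_def field_simps)
      moreover have "0 \<le> u * D" using u by (simp add: D_def)
      moreover have "2 \<le> 8 / pi * A"
      proof -
        have "1 \<le> A" using u u2 by (simp add: A_def field_simps)
        moreover have "2 \<le> 8 / pi" using pi_less_4 by (simp add: field_simps)
        ultimately show ?thesis using mult_mono[of 2 "8 / pi" 1 A] by simp
      qed
      ultimately show ?thesis
        using Li2_nonneg[of u] u unfolding distrib_left by linarith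
    qed
    ultimately show "\<exists>y. (V has_real_derivative y) (at u) \<and> y \<le> 0" by blast
  qed (use st in auto)
  moreover have "(1 - u\<^sup>2) * (- ln (1 - u) / u + 1 / (1 - u)) - u * (Li2 u + - ln (1 - u))
      - 8 / pi * arcsin u = V u"
    if "0 < u" "u < 1" for u
  proof -
    have "(1 - u\<^sup>2) * (1 / (1 - u)) = 1 + u"
      using that by (simp add: field_simps power2_eq_square)
    moreover have "(1 - u\<^sup>2) * (- ln (1 - u) / u) = - ln (1 - u) / u + u * ln (1 - u)"
      using that by (simp add: field_simps power2_eq_square)
    ultimately show ?thesis
      unfolding V_def m_def by (simp only: distrib_left)
  qed
  ultimately show "(1 - t\<^sup>2) * (- ln (1 - t) / t + 1 / (1 - t)) - t * (Li2 t + - ln (1 - t))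
        - 8 / pi * arcsin t
      \<le> (1 - s\<^sup>2) * (- ln (1 - s) / s + 1 / (1 - s)) - s * (Li2 s + - ln (1 - s))
        - 8 / pi * arcsin s"
    using st by simp
qed (use assms continuous_on_Li2 DERIV_Li2 in auto)

lemma Ti2_ge:
  assumes "0 \<le> t" "t \<le> 1"
  shows "t - t ^ 3 / 9 \<le> Ti2 t"
proof -
  define a where "a n = t ^ (2 * n + 1) / real (2 * n + 1) ^ 2" for n
  have "a \<longlonglongrightarrow> 0"
    unfolding a_def by (rule summable_LIMSEQ_zero[OF summable_chi2[OF assms]])
  moreover have "0 \<le> a n" for n using assms by (simp add: a_def)
  moreover have "a (Suc n) \<le> a n" for n
    unfolding a_def using assms by (intro frac_le power_decreasing power_mono) auto
  ultimately have "(\<Sum>i<2 * 1. (-1) ^ i * a i) \<le> (\<Sum>i. (-1) ^ i * a i)"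
    by (rule summable_Leibniz'(2))
  then show ?thesis
    by (simp add: a_def Ti2_def numeral_2_eq_2 power3_eq_cube)
qed

lemma arsinh_le_self:
  assumes "0 \<le> (t::real)"
  shows "arsinh t \<le> t"
proof -
  have "arsinh t - t \<le> arsinh 0 - 0"
  proof (rule DERIV_nonpos_imp_nonincreasing[OF assms])
    fix s :: real
    have "1 / sqrt (s\<^sup>2 + 1) \<le> 1"
      using frac_le[of 1 1 1 "sqrt (s\<^sup>2 + 1)"] by simp
    then show "\<exists>y. ((\<lambda>s. arsinh s - s) has_real_derivative y) (at s) \<and> y \<le> 0"
      by (intro exI[of _ "1 / sqrt (s\<^sup>2 + 1) - 1"]) (auto intro!: derivative_eq_intros)
  qed
  then show ?thesis by simp
qed

lemma Ti2_bound:
  assumes "0 \<le> t" "t \<le> 1"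
  shows "(arsinh t)\<^sup>2 / 2 \<le> t * Ti2 t"
proof -
  have "0 \<le> arsinh t" using assms arsinh_less_iff_real[of t 0] by (simp add: not_less[symmetric] del: arsinh_less_iff_real)
  then have "(arsinh t)\<^sup>2 \<le> t\<^sup>2"
    using arsinh_le_self assms by (intro power_mono)
  moreover have "t\<^sup>2 / 2 \<le> t * (t - t ^ 3 / 9)"
  proof -
    have "t ^ 3 \<le> t" using assms power_decreasing[of 1 3 t] by simp
    then have "t / 2 \<le> t - t ^ 3 / 9" using assms by simp
    then show ?thesis
      using mult_left_mono[of "t / 2" _ t] assms by (simp add: power2_eq_square)
  qed
  ultimately show ?thesis
    using mult_left_mono[OF Ti2_ge[OF assms] assms(1)] by linarith
qed

theorem theorem4p1:
  fixes t :: real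
  assumes "0 \<le> t" and "t \<le> 1"
  shows "Li2 t \<ge> (if t = 0 then 0 else 4 / (3 * pi) * ((arcsin t) ^ 3 / t)) \<and>
         chi2 t \<ge> (if t = 0 then 0 else (arcsin t) ^ 2 / (2 * t)) \<and>
         Ti2 t \<ge> (if t = 0 then 0 else (arsinh t) ^ 2 / (2 * t))"
proof (cases "t = 0")
  case True
  then show ?thesis by (simp add: Ti2_def)
next
  case False
  then have "0 < t" using assms by simp
  have divide: "x / t \<le> y" if "x \<le> t * y" for x y
    using that \<open>0 < t\<close> by (simp add: divide_le_eq mult.commute)
  show ?thesis
    using divide[OF Li2_bound[OF assms]] divide[OF chi2_bound[OF assms]]
      divide[OF Ti2_bound[OF assms]] False
    by simp
qed

end
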